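(* Let $n\ge1$. For every polynomial $c(x)$ of degree at most $n-1$, putting $d=\tilde F_n^{-1}c$, one has $$\tilde F_n\big(d(-x-n)\big)=(-1)^{n-1}x^{n-1}c(1/x).$$ In matrix form: $\tilde F_nE^{n}(1,-x)\tilde F_n^{-1}=(-1)^{n-1}\tilde J_n$, where $E^{n}c(x)=c(x+n)$, $(1,-x)$ is $c(x)\mapsto c(-x)$ and $\tilde J_nc(x)=x^{n-1}c(1/x)$.
   Context: Polynomials over $\mathbb{C}$; $(y)_p=y(y-1)\cdots(y-p+1)$, $[y]_k=y(y+1)\cdots(y+k-1)$. $\tilde F_n$ is the linear map on polynomials of degree at most $n-1$ with $\tilde F_nx^p=(1-x)^{2n+1}\sum_{m\ge0}(m+1)^{p+1}\binom{m+n+1}{n}x^m$ ($0\le p\le n-1$); it is invertible with $\tilde F_n^{-1}x^p=\frac{n!}{(2n)!}(x-1)_p[x+n+1]_{n-p-1}$. *)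

theory Defs
  imports
    "HOL-Computational_Algebra.Computational_Algebra"
    "Jordan_Normal_Form.Matrix"
begin

hide_const (open) Module.smult

definition poly_space :: "nat \<Rightarrow> complex poly set" where
  "poly_space n = {c. degree c \<le> n - 1}"

text \<open>
  The right-hand side below is a priori only a formal power series. That it is a polynomial
  for \<^prop>\<open>p < n\<close>, so that the description is proper, is \<open>fps_of_poly_Ftilde_monom\<close> below.
\<close>

definition Ftilde_monom :: "nat \<Rightarrow> nat \<Rightarrow> complex poly" where
  "Ftilde_monom n p = (THE q. fps_of_poly q =
     (1 - fps_X) ^ (2 * n + 1) *
     Abs_fps (\<lambda>m. of_nat (m + 1) ^ (p + 1) * of_nat ((m + n + 1) choose n)))"

text \<open>Linear extension; only meaningful on \<^term>\<open>poly_space n\<close>.\<close>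

definition Ftilde :: "nat \<Rightarrow> complex poly \<Rightarrow> complex poly" where
  "Ftilde n c = (\<Sum>p<n. smult (coeff c p) (Ftilde_monom n p))"

definition Ftilde_inv :: "nat \<Rightarrow> complex poly \<Rightarrow> complex poly" where
  "Ftilde_inv n = inv_into (poly_space n) (Ftilde n)"

definition shift :: "complex \<Rightarrow> complex poly \<Rightarrow> complex poly" where
  "shift a c = c \<circ>\<^sub>p [:a, 1:]"

text \<open>The operator \<open>(1, -x)\<close>.\<close>

definition reflection :: "complex poly \<Rightarrow> complex poly" where
  "reflection c = c \<circ>\<^sub>p [:0, -1:]"

text \<open>
  \<open>x\<^bsup>n-1\<^esup> c(1/x)\<close>. The library's \<^const>\<open>reflect_poly\<close> uses the exponent \<^term>\<open>degree c\<close> instead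
  of \<open>n - 1\<close>.
\<close>

definition Jtilde :: "nat \<Rightarrow> complex poly \<Rightarrow> complex poly" where
  "Jtilde n c = (\<Sum>k<n. monom (coeff c k) (n - 1 - k))"

text \<open>Column \<open>j\<close> holds the coefficients of the image of \<open>x\<^bsup>j\<^esup>\<close>.\<close>

definition op_mat :: "nat \<Rightarrow> (complex poly \<Rightarrow> complex poly) \<Rightarrow> complex mat" where
  "op_mat n T = mat n n (\<lambda>(i, j). coeff (T (monom 1 j)) i)"

lemma poly_Jtilde:
  assumes "n \<ge> 1" "c \<in> poly_space n" "x \<noteq> 0"
  shows "poly (Jtilde n c) x = x ^ (n - 1) * poly c (1 / x)"
proof -
  have "poly c (1 / x) = (\<Sum>k\<le>n - 1. coeff c k * (1 / x) ^ k)"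
    unfolding poly_altdef using assms
    by (intro sum.mono_neutral_left) (auto simp: poly_space_def coeff_eq_0)
  also have "{..n - 1} = {..<n}"
    using assms by auto
  finally show ?thesis
    using assms
    by (auto simp: Jtilde_def poly_sum poly_monom sum_distrib_left power_diff power_one_over
        divide_simps intro!: sum.cong)
qed


subsection \<open>Well-definedness and invertibility of \<^const>\<open>Ftilde\<close>\<close>

definition Ftilde_fps :: "nat \<Rightarrow> complex poly \<Rightarrow> complex fps" where
  "Ftilde_fps n d = (1 - fps_X) ^ (2 * n + 1) *
     Abs_fps (\<lambda>m. of_nat (m + 1) * poly d (of_nat (m + 1)) * of_nat ((m + n + 1) choose n))"

lemma Ftilde_fps_sum:
  "Ftilde_fps n (\<Sum>p\<in>A. smult (e p) (f p)) = (\<Sum>p\<in>A. fps_const (e p) * Ftilde_fps n (f p))"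
proof -
  have "Abs_fps (\<lambda>m. of_nat (m + 1) * poly (\<Sum>p\<in>A. smult (e p) (f p)) (of_nat (m + 1)) *
            of_nat ((m + n + 1) choose n)) =
        (\<Sum>p\<in>A. fps_const (e p) * Abs_fps (\<lambda>m. of_nat (m + 1) * poly (f p) (of_nat (m + 1)) *
            of_nat ((m + n + 1) choose n)))"
    by (rule fps_ext) (simp add: fps_sum_nth poly_sum sum_distrib_left sum_distrib_right mult_ac)
  then show ?thesis
    unfolding Ftilde_fps_def by (simp only: sum_distrib_left mult.left_commute)
qed

lemma Ftilde_fps_inj:
  assumes "Ftilde_fps n d = Ftilde_fps n e"
  shows "d = e"
proof -
  have "(1 - fps_X :: complex fps) \<noteq> 0"
    by (metis fps_X_neq_one eq_iff_diff_eq_0)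
  then have nz: "(1 - fps_X :: complex fps) ^ (2 * n + 1) \<noteq> 0"
    by simp
  have "poly d (of_nat (m + 1)) = poly e (of_nat (m + 1))" for m
  proof -
    have "Abs_fps (\<lambda>m. of_nat (m + 1) * poly d (of_nat (m + 1)) * of_nat ((m + n + 1) choose n)) =
      Abs_fps (\<lambda>m. of_nat (m + 1) * poly e (of_nat (m + 1)) * of_nat ((m + n + 1) choose n))"
      using assms unfolding Ftilde_fps_def by (rule mult_left_cancel[OF nz, THEN iffD1])
    from arg_cong[OF this, of "\<lambda>f. fps_nth f m"]
    have "of_nat (m + 1) * poly d (of_nat (m + 1)) * of_nat ((m + n + 1) choose n) =
      of_nat (m + 1) * poly e (of_nat (m + 1)) * of_nat ((m + n + 1) choose n)"
      by (simp only: fps_nth_Abs_fps)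
    moreover have "of_nat (m + 1) \<noteq> (0 :: complex)"
      unfolding Suc_eq_plus1 [symmetric] by (rule of_nat_neq_0)
    moreover have "of_nat ((m + n + 1) choose n) \<noteq> (0 :: complex)"
      by (simp only: of_nat_eq_0_iff binomial_eq_0_iff)
    ultimately show ?thesis
      using mult_right_cancel mult_left_cancel by blast
  qed
  then have "range (\<lambda>m. of_nat (m + 1)) \<subseteq> {x. poly (d - e) x = 0}"
    by auto
  moreover have "infinite (range (\<lambda>m. of_nat (m + 1) :: complex))"
    by (rule range_inj_infinite) (auto intro!: injI)
  ultimately have "infinite {x. poly (d - e) x = 0}"
    using finite_subset by blast
  then show ?thesis
    using poly_roots_finite[of "d - e"] by auto
qed

lemma one_minus_X_power_mult_binomial_series:
  "(1 - fps_X) ^ (k + 1) * Abs_fps (\<lambda>m. of_nat ((m + k) choose k)) = (1 :: complex fps)"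
proof (induction k)
  case 0
  show ?case
    by (rule fps_ext) (auto simp: left_diff_distrib fps_X_mult_nth)
next
  case (Suc k)
  have "(1 - fps_X) * Abs_fps (\<lambda>m. of_nat ((m + Suc k) choose Suc k)) =
      (Abs_fps (\<lambda>m. of_nat ((m + k) choose k)) :: complex fps)"
  proof (rule fps_ext)
    fix m
    show "fps_nth ((1 - fps_X) * Abs_fps (\<lambda>m. of_nat ((m + Suc k) choose Suc k))) m =
      fps_nth (Abs_fps (\<lambda>m. of_nat ((m + k) choose k)) :: complex fps) m"
      by (cases m) (simp_all add: left_diff_distrib fps_X_mult_nth)
  qed
  then show ?case
    using Suc by (simp only: power_Suc2 mult.assoc Suc_eq_plus1 [symmetric])
qed

text \<open>\<open>(x - 1)\<^sub>p [x + b]\<^bsub>n-p-1\<^esub>\<close>\<close>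

definition Ftilde_basis :: "nat \<Rightarrow> nat \<Rightarrow> nat \<Rightarrow> complex poly" where
  "Ftilde_basis b n p =
     (\<Prod>i<p. [:- 1 - of_nat i, 1:]) * pochhammer [:of_nat b, 1:] (n - p - 1)"

lemma poly_pochhammer: "poly (pochhammer q k) x = pochhammer (poly q x) k"
  by (simp add: pochhammer_prod poly_prod)

lemma pochhammer_of_nat_fact:
  "fact a * pochhammer (of_nat a + 1) k = (fact (a + k) :: complex)"
proof (induction k)
  case (Suc k)
  have "fact a * pochhammer (of_nat a + 1) (Suc k) =
      fact a * pochhammer (of_nat a + 1) k * (of_nat (a + k + 1) :: complex)"
    by (simp add: pochhammer_Suc mult_ac add_ac)
  also have "\<dots> = fact (a + Suc k)"
    unfolding Suc by (simp add: mult_ac add_ac)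
  finally show ?case .
qed simp

lemma prod_diff_fact:
  assumes "p \<le> m"
  shows "fact (m - p) * (\<Prod>i<p. of_nat m - of_nat i) = (fact m :: complex)"
  using assms
proof (induction p)
  case (Suc p)
  have "fact (m - p) = (of_nat m - of_nat p) * (fact (m - Suc p) :: complex)"
    using Suc.prems
    by (metis Suc_diff_Suc Suc_le_lessD fact_Suc of_nat_diff Suc_leD)
  then show ?case
    using Suc by (simp add: mult_ac)
qed simp

lemma Ftilde_fps_basis:
  assumes "p < n"
  shows "Ftilde_fps n (smult (fact n / fact (2 * n)) (Ftilde_basis (n + 1) n p)) = fps_X ^ p"
proof -
  have coeffs: "of_nat (m + 1) *
      poly (smult (fact n / fact (2 * n)) (Ftilde_basis (n + 1) n p)) (of_nat (m + 1)) *
      of_nat ((m + n + 1) choose n) =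
      (if m < p then 0 else (of_nat ((m - p + 2 * n) choose (2 * n)) :: complex))" for m
  proof (cases "m < p")
    case True
    then have "(\<Prod>i<p. of_nat m - of_nat i) = (0 :: complex)"
      by (auto simp: prod_zero_iff)
    then show ?thesis
      using True by (simp add: Ftilde_basis_def poly_prod poly_pochhammer)
  next
    case False
    then have le: "p \<le> m" by simp
    define P where "P = (\<Prod>i<p. of_nat m - of_nat i :: complex)"
    define Q where "Q = pochhammer (of_nat (m + n + 1) + 1 :: complex) (n - p - 1)"
    have P: "fact (m - p) * P = fact m"
      unfolding P_def by (rule prod_diff_fact[OF le])
    have "m + n + 1 + (n - p - 1) = m - p + 2 * n"
      using le assms by simp
    then have Q: "fact (m + n + 1) * Q = fact (m - p + 2 * n)"
      unfolding Q_def by (metis pochhammer_of_nat_fact)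
    have cancel: "M * (a / b * (P * Q)) * (F / (a * (M * (g * P)))) = F * Q / (b * g)"
      if "M \<noteq> 0" "P \<noteq> 0" "a \<noteq> 0" "b \<noteq> 0" "g \<noteq> 0" for M a b F g :: complex
      using that by (simp add: field_simps)
    have PQ: "poly (Ftilde_basis (n + 1) n p) (of_nat (m + 1)) = P * Q"
      by (simp add: Ftilde_basis_def P_def Q_def poly_prod poly_pochhammer add_ac)
    have c1: "(of_nat ((m + n + 1) choose n) :: complex) =
        fact (m + n + 1) / (fact n * fact (m + 1))"
      by (subst binomial_fact) (simp_all add: Suc_diff_le)
    have c2: "(of_nat ((m - p + 2 * n) choose (2 * n)) :: complex) =
        fact (m - p + 2 * n) / (fact (2 * n) * fact (m - p))"
      by (subst binomial_fact) simp_all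
    have c3: "(fact (m + 1) :: complex) = of_nat (m + 1) * (fact (m - p) * P)"
      unfolding P by simp
    have "of_nat (m + 1) \<noteq> (0 :: complex)"
      unfolding Suc_eq_plus1 [symmetric] by (rule of_nat_neq_0)
    moreover have "P \<noteq> 0"
      using P by (metis fact_nonzero mult_zero_right)
    ultimately have "of_nat (m + 1) * (fact n / fact (2 * n) * (P * Q)) *
        (fact (m + n + 1) / (fact n * (of_nat (m + 1) * (fact (m - p) * P)))) =
        fact (m + n + 1) * Q / (fact (2 * n) * fact (m - p))"
      by (rule cancel) simp_all
    then show ?thesis
      unfolding Q poly_smult PQ c1 c2 c3 using False by simp
  qed
  have "Ftilde_fps n (smult (fact n / fact (2 * n)) (Ftilde_basis (n + 1) n p)) =
      (1 - fps_X) ^ (2 * n + 1) *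
      (fps_X ^ p * Abs_fps (\<lambda>m. of_nat ((m + 2 * n) choose (2 * n))))"
    unfolding Ftilde_fps_def coeffs
    by (rule arg_cong[of _ _ "\<lambda>f. (1 - fps_X) ^ (2 * n + 1) * f"], rule fps_ext)
       (simp add: fps_X_power_mult_nth)
  then show ?thesis
    unfolding mult.left_commute[of _ "fps_X ^ p"] one_minus_X_power_mult_binomial_series by simp
qed

lemma degree_Ftilde_basis:
  assumes "p < n"
  shows "degree (Ftilde_basis b n p) \<le> n - 1"
proof -
  have "degree (\<Prod>i<p. [:- 1 - of_nat i, 1:] :: complex poly) \<le> (\<Sum>i<p. 1)"
    by (rule order.trans[OF degree_prod_sum_le]) (auto intro!: sum_mono)
  moreover have "degree (pochhammer [:of_nat b, 1 :: complex:] (n - p - 1)) \<le> (\<Sum>i<n - p - 1. 1)"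
    unfolding pochhammer_prod atLeast0LessThan
    by (rule order.trans[OF degree_prod_sum_le])
       (auto intro!: sum_mono simp: of_nat_poly)
  ultimately show ?thesis
    using assms degree_mult_le[of "\<Prod>i<p. [:- 1 - of_nat i, 1:]"
      "pochhammer [:of_nat b, 1 :: complex:] (n - p - 1)"]
    by (simp add: Ftilde_basis_def)
qed

lemma Ftilde_basis_span:
  assumes "degree d < n"
  shows "\<exists>e. d = (\<Sum>p<n. smult (e p) (Ftilde_basis b n p))"
  using assms
proof (induction n arbitrary: d)
  case (Suc n)
  show ?case
  proof (cases "n = 0")
    case True
    then obtain a where "d = [:a:]"
      using Suc.prems by (metis less_Suc0 degree_eq_zeroE)
    then show ?thesis
      using True by (intro exI[of _ "\<lambda>_. a"]) (simp add: Ftilde_basis_def)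
  next
    case False
    let ?B = "Ftilde_basis b (Suc n)"
    define N where "N = (of_nat (b + n) :: complex)"
    have N: "N \<noteq> 0"
      using False unfolding N_def of_nat_eq_0_iff by simp
    have step: "smult N (Ftilde_basis b n p) = ?B p - ?B (Suc p)" if "p < n" for p
    proof -
      have *: "Suc n - p - 1 = Suc (n - p - 1)"
        using that by simp
      have "?B p = (\<Prod>i<p. [:- 1 - of_nat i, 1:]) * pochhammer [:of_nat b, 1:] (n - p - 1) *
          [:of_nat b + of_nat (n - p - 1), 1:]"
        unfolding Ftilde_basis_def * pochhammer_Suc mult.assoc
        by (simp only: of_nat_poly add_pCons add_0_right)
      moreover have "?B (Suc p) = (\<Prod>i<p. [:- 1 - of_nat i, 1:]) *
          pochhammer [:of_nat b, 1:] (n - p - 1) * [:- 1 - of_nat p, 1:]"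
        unfolding Ftilde_basis_def
        by (simp only: prod.lessThan_Suc diff_Suc_Suc mult_ac)
      ultimately have "?B p - ?B (Suc p) = Ftilde_basis b n p *
          ([:of_nat b + of_nat (n - p - 1), 1:] - [:- 1 - of_nat p, 1:])"
        by (simp only: Ftilde_basis_def right_diff_distrib)
      also have "[:of_nat b + of_nat (n - p - 1), 1:] - [:- 1 - of_nat p, 1:] = [:N:]"
        using that by (simp add: N_def of_nat_diff)
      finally show ?thesis
        by (simp add: mult.commute)
    qed
    define q where "q = d - smult (coeff d n) (?B 0)"
    have B0: "coeff (?B 0) n = 1" "degree (?B 0) \<le> n"
    proof -
      have lc: "lead_coeff (?B 0) = 1"
        unfolding Ftilde_basis_def pochhammer_prod
        by (simp add: lead_coeff_mult lead_coeff_prod of_nat_poly)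
      have "degree (?B 0) = n"
        unfolding Ftilde_basis_def pochhammer_prod
        by (simp add: degree_prod_eq_sum_degree of_nat_poly)
      with lc show "coeff (?B 0) n = 1" "degree (?B 0) \<le> n" by simp_all
    qed
    have "degree q \<le> n"
      unfolding q_def using Suc.prems B0
      by (intro degree_diff_le order.trans[OF degree_smult_le]) simp_all
    moreover have "coeff q n = 0"
      by (simp add: q_def B0)
    ultimately have "degree q < n"
      using False by (metis degree_0 eq_zero_or_degree_less gr0I)
    then obtain e where e: "q = (\<Sum>p<n. smult (e p) (Ftilde_basis b n p))"
      using Suc.IH by blast
    define f where "f p = e p / N" for p
    have "q = (\<Sum>p<n. smult (f p) (smult N (Ftilde_basis b n p)))"
      unfolding e f_def using N by simp
    also have "\<dots> = (\<Sum>p<n. smult (f p) (?B p)) - (\<Sum>p<n. smult (f p) (?B (Suc p)))"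
      by (simp add: step smult_diff_right sum_subtractf)
    finally have d: "d = smult (coeff d n) (?B 0) + (\<Sum>p<n. smult (f p) (?B p)) -
        (\<Sum>p<n. smult (f p) (?B (Suc p)))"
      by (simp add: q_def algebra_simps)
    define g where "g p = (if p = 0 then coeff d n else 0) + (if p < n then f p else 0) -
        (case p of 0 \<Rightarrow> 0 | Suc r \<Rightarrow> f r)" for p
    have "(\<Sum>p<Suc n. smult (g p) (?B p)) =
        (\<Sum>p<Suc n. smult (if p = 0 then coeff d n else 0) (?B p)) +
        (\<Sum>p<Suc n. smult (if p < n then f p else 0) (?B p)) -
        (\<Sum>p<Suc n. smult (case p of 0 \<Rightarrow> 0 | Suc r \<Rightarrow> f r) (?B p))"
      by (simp only: g_def smult_add_left smult_diff_left sum.distrib sum_subtractf)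
    also have "(\<Sum>p<Suc n. smult (if p = 0 then coeff d n else 0) (?B p)) =
        smult (coeff d n) (?B 0)"
      by (subst sum.lessThan_Suc_shift) simp
    also have "(\<Sum>p<Suc n. smult (if p < n then f p else 0) (?B p)) =
        (\<Sum>p<n. smult (f p) (?B p))"
      by simp
    also have "(\<Sum>p<Suc n. smult (case p of 0 \<Rightarrow> 0 | Suc r \<Rightarrow> f r) (?B p)) =
        (\<Sum>p<n. smult (f p) (?B (Suc p)))"
      by (subst sum.lessThan_Suc_shift) simp
    finally show ?thesis
      using d by metis
  qed
qed simp

lemma Ftilde_fps_polynomial:
  assumes "n \<ge> 1" "d \<in> poly_space n"
  shows "\<exists>q\<in>poly_space n. fps_of_poly q = Ftilde_fps n d"
proof -
  obtain e where e: "d = (\<Sum>p<n. smult (e p) (Ftilde_basis (n + 1) n p))"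
    using Ftilde_basis_span[of d n "n + 1"] assms unfolding poly_space_def by force
  define K where "K = (fact n / fact (2 * n) :: complex)"
  have "K \<noteq> 0" by (simp add: K_def)
  then have d: "d = (\<Sum>p<n. smult (e p / K) (smult K (Ftilde_basis (n + 1) n p)))"
    by (simp add: e)
  define q where "q = (\<Sum>p<n. monom (e p / K) p)"
  have "fps_of_poly q = Ftilde_fps n d"
    unfolding d Ftilde_fps_sum
    unfolding q_def K_def fps_of_poly_sum fps_of_poly_monom
    by (intro sum.cong refl) (simp only: Ftilde_fps_basis lessThan_iff)
  moreover have "degree q \<le> n - 1"
    unfolding q_def
    by (rule degree_sum_le) (auto intro: order.trans[OF degree_monom_le])
  ultimately show ?thesis
    by (auto simp: poly_space_def)
qed

lemma Ftilde_fps_monom: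
  "Ftilde_fps n (monom 1 p) = (1 - fps_X) ^ (2 * n + 1) *
     Abs_fps (\<lambda>m. of_nat (m + 1) ^ (p + 1) * of_nat ((m + n + 1) choose n))"
  by (simp add: Ftilde_fps_def poly_monom)

lemma
  assumes "p < n"
  shows fps_of_poly_Ftilde_monom: "fps_of_poly (Ftilde_monom n p) =
      (1 - fps_X) ^ (2 * n + 1) *
      Abs_fps (\<lambda>m. of_nat (m + 1) ^ (p + 1) * of_nat ((m + n + 1) choose n))"
    and Ftilde_monom_in_poly_space: "Ftilde_monom n p \<in> poly_space n"
proof -
  let ?f = "(1 - fps_X) ^ (2 * n + 1) *
      Abs_fps (\<lambda>m. of_nat (m + 1) ^ (p + 1) * of_nat ((m + n + 1) choose n)) :: complex fps"
  have mem: "monom 1 p \<in> poly_space n" and "n \<ge> 1"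
    using assms by (simp_all add: poly_space_def degree_monom_eq)
  obtain q where q: "q \<in> poly_space n" "fps_of_poly q = ?f"
    using Ftilde_fps_polynomial[OF \<open>n \<ge> 1\<close> mem] unfolding Ftilde_fps_monom by (elim bexE)
  have "Ftilde_monom n p = q"
    unfolding Ftilde_monom_def
  proof (rule the_equality)
    show "r = q" if "fps_of_poly r = ?f" for r
      by (rule iffD1[OF fps_of_poly_eq_iff], rule trans[OF that q(2) [symmetric]])
  qed (rule q(2))
  then show "fps_of_poly (Ftilde_monom n p) = ?f" "Ftilde_monom n p \<in> poly_space n"
    by (simp_all only: q)
qed

lemma Ftilde_in_poly_space: "Ftilde n d \<in> poly_space n"
  using Ftilde_monom_in_poly_space unfolding Ftilde_def poly_space_def
  by (auto intro!: degree_sum_le order.trans[OF degree_smult_le])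

lemma Ftilde_monom_eq:
  assumes "p < n"
  shows "Ftilde n (monom 1 p) = Ftilde_monom n p"
proof -
  have "Ftilde n (monom 1 p) = (\<Sum>k<n. if k = p then Ftilde_monom n k else 0)"
    unfolding Ftilde_def by (rule sum.cong) auto
  then show ?thesis
    using assms by simp
qed

lemma fps_of_poly_Ftilde:
  assumes "n \<ge> 1" "d \<in> poly_space n"
  shows "fps_of_poly (Ftilde n d) = Ftilde_fps n d"
proof -
  have "{..n - 1} = {..<n}"
    using assms by auto
  then have d: "d = (\<Sum>p<n. smult (coeff d p) (monom 1 p))"
    using poly_as_sum_of_monoms'[of d "n - 1"] assms
    by (simp add: poly_space_def smult_monom)
  have "Ftilde_fps n d = (\<Sum>p<n. fps_const (coeff d p) * Ftilde_fps n (monom 1 p))"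
    by (subst d) (rule Ftilde_fps_sum)
  also have "\<dots> = fps_of_poly (Ftilde n d)"
    unfolding Ftilde_fps_monom
    by (auto simp: Ftilde_def fps_of_poly_sum fps_of_poly_smult fps_of_poly_Ftilde_monom
        intro!: sum.cong simp del: power_Suc)
  finally show ?thesis ..
qed

lemma Ftilde_basis_eq:
  assumes "p < n"
  shows "Ftilde n (smult (fact n / fact (2 * n)) (Ftilde_basis (n + 1) n p)) = monom 1 p"
proof -
  have "smult (fact n / fact (2 * n)) (Ftilde_basis (n + 1) n p) \<in> poly_space n"
    using degree_Ftilde_basis[OF assms] by (simp add: poly_space_def)
  then show ?thesis
    using assms
    by (subst fps_of_poly_eq_iff [symmetric], subst fps_of_poly_Ftilde)
       (simp_all only: Ftilde_fps_basis fps_of_poly_monom')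
qed

lemma bij_betw_Ftilde:
  assumes "n \<ge> 1"
  shows "bij_betw (Ftilde n) (poly_space n) (poly_space n)"
proof (rule bij_betwI')
  fix d e assume "d \<in> poly_space n" "e \<in> poly_space n"
  then show "Ftilde n d = Ftilde n e \<longleftrightarrow> d = e"
    using Ftilde_fps_inj fps_of_poly_Ftilde[OF assms] by metis
next
  fix c assume c: "c \<in> poly_space n"
  define b where "b p = smult (fact n / fact (2 * n)) (Ftilde_basis (n + 1) n p)" for p
  define d where "d = (\<Sum>p<n. smult (coeff c p) (b p))"
  have d: "d \<in> poly_space n"
    unfolding d_def poly_space_def b_def using degree_Ftilde_basis
    by (auto intro!: degree_sum_le order.trans[OF degree_smult_le])
  have "fps_of_poly (Ftilde n d) = (\<Sum>p<n. fps_const (coeff c p) * fps_X ^ p)"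
    unfolding fps_of_poly_Ftilde[OF assms d] unfolding d_def Ftilde_fps_sum b_def
    by (intro sum.cong refl) (simp only: Ftilde_fps_basis lessThan_iff)
  also have "\<dots> = fps_of_poly (\<Sum>p<n. monom (coeff c p) p)"
    by (simp add: fps_of_poly_sum fps_of_poly_monom)
  also have "(\<Sum>p<n. monom (coeff c p) p) = c"
  proof -
    have "{..n - 1} = {..<n}"
      using assms by auto
    then show ?thesis
      using poly_as_sum_of_monoms'[of c "n - 1"] c by (simp add: poly_space_def)
  qed
  finally show "\<exists>d\<in>poly_space n. c = Ftilde n d"
    using d by (metis fps_of_poly_eq_iff)
qed (rule Ftilde_in_poly_space)

lemma Ftilde_inv_monom:
  assumes "p < n"
  shows "Ftilde_inv n (monom 1 p) =
    smult (fact n / fact (2 * n))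
      ((\<Prod>i<p. [:- 1 - of_nat i, 1:]) * pochhammer [:of_nat n + 1, 1:] (n - p - 1))"
proof -
  let ?b = "smult (fact n / fact (2 * n)) (Ftilde_basis (n + 1) n p)"
  have "inj_on (Ftilde n) (poly_space n)"
    using bij_betw_Ftilde[of n] assms by (simp add: bij_betw_def)
  moreover have "?b \<in> poly_space n"
    using degree_Ftilde_basis[OF assms] by (simp add: poly_space_def)
  ultimately have "Ftilde_inv n (Ftilde n ?b) = ?b"
    unfolding Ftilde_inv_def by (rule inv_into_f_f)
  then show ?thesis
    unfolding Ftilde_basis_eq[OF assms] by (simp add: Ftilde_basis_def add.commute)
qed

end

theory Submission
  imports Defs
begin

text \<open>
  The substitution \<open>x \<mapsto> -x - n\<close> exchanges the two factors of the basis polynomial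
  \<open>(x - 1)\<^sub>p [x + n + 1]\<^bsub>n-p-1\<^esub>\<close> up to signs, so it maps the \<open>p\<close>-th basis polynomial to
  \<open>(-1)\<^bsup>n-1\<^esup>\<close> times the \<open>(n-1-p)\<close>-th one. These polynomials are, up to a common factor, the
  preimages of the monomials, hence after conjugation \<open>x\<^sup>p\<close> goes to \<open>(-1)\<^bsup>n-1\<^esup> x\<^bsup>n-1-p\<^esup>\<close>.
\<close>

text \<open>Linearity is phrased as \<open>module_hom\<close> so that the general laws for sums,
  scalars and compositions apply to all operators involved.\<close>

lemma module_smult_poly: "Modules.module (smult :: 'a::comm_ring_1 \<Rightarrow> 'a poly \<Rightarrow> 'a poly)"
  by unfold_locales (simp_all add: smult_add_left smult_add_right)

lemma smult_sum_right: "smult a (\<Sum>p\<in>A. f p) = (\<Sum>p\<in>A. smult a (f p))"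
  by (induction A rule: infinite_finite_induct) (simp_all add: smult_add_right)

lemma module_hom_smultI:
  fixes T :: "'a::comm_ring_1 poly \<Rightarrow> 'a poly"
  assumes "\<And>c d. T (c + d) = T c + T d" "\<And>a c. T (smult a c) = smult a (T c)"
  shows "module_hom smult smult T"
  using assms by (simp add: module_hom_iff module_smult_poly)

lemma module_hom_sum_smult:
  assumes "module_hom smult smult T"
  shows "T (\<Sum>p\<in>A. smult (e p) (f p)) = (\<Sum>p\<in>A. smult (e p) (T (f p)))"
  by (simp add: module_hom.sum[OF assms] module_hom.scale[OF assms])

lemma module_hom_pcompose: "module_hom smult smult (\<lambda>c :: 'a::comm_ring_1 poly. c \<circ>\<^sub>p q)"
  by (rule module_hom_smultI) (simp_all add: pcompose_add pcompose_smult)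

text \<open>No degree bound is required: \<open>Ftilde n\<close> reads off the first
  \<open>n\<close> coefficients, each of which depends linearly on the polynomial.\<close>

lemma module_hom_Ftilde: "module_hom smult smult (Ftilde n)"
  by (rule module_hom_smultI)
     (simp_all add: Ftilde_def smult_add_left sum.distrib smult_sum_right)

lemma poly_space_eq_sum_monom:
  assumes "n \<ge> 1" "c \<in> poly_space n"
  shows "c = (\<Sum>k<n. smult (coeff c k) (monom 1 k))"
proof -
  have "{..n - 1} = {..<n}"
    using assms by auto
  then show ?thesis
    using poly_as_sum_of_monoms'[of c "n - 1"] assms
    by (simp add: poly_space_def smult_monom)
qed

lemma pcompose_linear_in_poly_space:
  assumes "d \<in> poly_space n"
  shows "d \<circ>\<^sub>p [:a, b:] \<in> poly_space n"
proof -
  have "degree (d \<circ>\<^sub>p [:a, b:]) \<le> degree d * 1"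
    by (rule order.trans[OF degree_pcompose_le]) (intro mult_left_mono, auto)
  then show ?thesis
    using assms by (simp add: poly_space_def)
qed

lemma Ftilde_inv_in_poly_space:
  assumes "n \<ge> 1" "c \<in> poly_space n"
  shows "Ftilde_inv n c \<in> poly_space n"
  using bij_betw_Ftilde[OF assms(1)] assms(2) unfolding Ftilde_inv_def bij_betw_def
  by (metis inv_into_into)

text \<open>As an \<open>inv_into\<close>, \<open>Ftilde_inv n\<close> is unspecified outside
  \<open>poly_space n\<close>, so it is not treated as a \<open>module_hom\<close>. Its linearity on
  that space is recovered by applying \<open>Ftilde n\<close> to the right-hand side and using
  injectivity.\<close>

lemma Ftilde_inv_eq_sum:
  assumes "n \<ge> 1" "c \<in> poly_space n"
  shows "Ftilde_inv n c = (\<Sum>p<n. smult (coeff c p) (Ftilde_inv n (monom 1 p)))"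
proof -
  let ?d = "\<Sum>p<n. smult (coeff c p) (Ftilde_inv n (monom 1 p))"
  have inj: "inj_on (Ftilde n) (poly_space n)"
    using bij_betw_Ftilde[OF assms(1)] by (simp add: bij_betw_def)
  have mono: "monom 1 p \<in> poly_space n" if "p < n" for p
    using that by (simp add: poly_space_def degree_monom_eq)
  have d: "?d \<in> poly_space n"
    using Ftilde_inv_in_poly_space[OF assms(1) mono] unfolding poly_space_def
    by (auto intro!: degree_sum_le order.trans[OF degree_smult_le])
  have "Ftilde n ?d = (\<Sum>p<n. smult (coeff c p) (Ftilde n (Ftilde_inv n (monom 1 p))))"
    by (rule module_hom_sum_smult[OF module_hom_Ftilde])
  also have "\<dots> = (\<Sum>p<n. smult (coeff c p) (monom 1 p))"
  proof (intro sum.cong refl)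
    fix p assume "p \<in> {..<n}"
    then have "Ftilde n (Ftilde_inv n (monom 1 p)) = monom 1 p"
      using bij_betw_Ftilde[OF assms(1)] mono[of p] unfolding Ftilde_inv_def bij_betw_def
      by (metis f_inv_into_f lessThan_iff)
    then show "smult (coeff c p) (Ftilde n (Ftilde_inv n (monom 1 p))) =
        smult (coeff c p) (monom 1 p)"
      by simp
  qed
  also have "\<dots> = c"
    using poly_space_eq_sum_monom[OF assms] by simp
  finally have "Ftilde n ?d = c" .
  then show ?thesis
    using inv_into_f_f[OF inj d] by (simp only: Ftilde_inv_def)
qed

text \<open>With both factors written as rising factorials, of 1 - y and y + n + 1, the substitution
  y = -x - n turns these arguments into x + n + 1 and 1 - x, that is, swaps them.\<close>

lemma Ftilde_basis_pcompose:
  assumes "p < n"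
  shows "Ftilde_basis (n + 1) n p \<circ>\<^sub>p [:- of_nat n, -1:] =
    smult ((-1) ^ (n - 1)) (Ftilde_basis (n + 1) n (n - 1 - p))"
proof (rule iffD1[OF poly_eq_poly_eq_iff], rule ext)
  fix x :: complex
  \<comment> \<open>Each factor is -((1 - y) + i).\<close>
  have falling: "(\<Prod>i<k. y - 1 - of_nat i) = (-1) ^ k * pochhammer (1 - y) k" for y :: complex and k
    by (induction k) (simp_all add: pochhammer_Suc algebra_simps)
  have basis: "poly (Ftilde_basis (n + 1) n q) y =
      (-1) ^ q * pochhammer (1 - y) q * pochhammer (y + of_nat n + 1) (n - q - 1)" for q y
    unfolding falling[symmetric]
    by (simp add: Ftilde_basis_def poly_prod poly_pochhammer diff_diff_eq2 algebra_simps)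
  \<comment> \<open>The left side contributes (-1)^p, the falling factor of index n - 1 - p on the
    right (-1)^(n-1-p); the global sign makes up the difference.\<close>
  have sign: "(-1) ^ (n - 1) * (-1) ^ (n - 1 - p) = ((-1) ^ p :: complex)"
  proof -
    have "n - 1 + (n - 1 - p) = p + 2 * (n - 1 - p)"
      using assms by simp
    then show ?thesis
      by (simp flip: power_add) (simp add: power_add power_mult)
  qed
  have swap: "n - (n - 1 - p) - 1 = p" "n - p - 1 = n - 1 - p"
    using assms by linarith+
  have "poly (Ftilde_basis (n + 1) n p \<circ>\<^sub>p [:- of_nat n, -1:]) x =
      (-1) ^ p * pochhammer (x + of_nat n + 1) p * pochhammer (1 - x) (n - 1 - p)"
    unfolding poly_pcompose basis swap(2) by (simp add: algebra_simps)
  also have "\<dots> = (-1) ^ (n - 1) * ((-1) ^ (n - 1 - p) * pochhammer (1 - x) (n - 1 - p) *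
      pochhammer (x + of_nat n + 1) p)"
    by (simp only: sign [symmetric] mult_ac)
  also have "\<dots> = poly (smult ((-1) ^ (n - 1)) (Ftilde_basis (n + 1) n (n - 1 - p))) x"
    unfolding poly_smult basis swap(1) ..
  finally show "poly (Ftilde_basis (n + 1) n p \<circ>\<^sub>p [:- of_nat n, -1:]) x =
      poly (smult ((-1) ^ (n - 1)) (Ftilde_basis (n + 1) n (n - 1 - p))) x" .
qed

text \<open>The normalising factor n!/(2n)! is the same for every \<open>p\<close>, so the swap of
  basis polynomials carries over to the preimages of monomials.\<close>

lemma Ftilde_reflect_Ftilde_inv_monom:
  assumes "p < n"
  shows "Ftilde n (Ftilde_inv n (monom 1 p) \<circ>\<^sub>p [:- of_nat n, -1:]) =
    smult ((-1) ^ (n - 1)) (monom 1 (n - 1 - p))"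
proof -
  let ?K = "fact n / fact (2 * n) :: complex"
  have "Ftilde_inv n (monom 1 p) = smult ?K (Ftilde_basis (n + 1) n p)"
    unfolding Ftilde_inv_monom[OF assms] Ftilde_basis_def by (simp add: add.commute)
  then have "Ftilde_inv n (monom 1 p) \<circ>\<^sub>p [:- of_nat n, -1:] =
      smult ((-1) ^ (n - 1)) (smult ?K (Ftilde_basis (n + 1) n (n - 1 - p)))"
    by (simp add: pcompose_smult Ftilde_basis_pcompose[OF assms, simplified] mult.commute)
  moreover have "n - 1 - p < n"
    using assms by simp
  ultimately show ?thesis
    by (simp only: module_hom.scale[OF module_hom_Ftilde, of _ "(-1) ^ (n - 1)"] Ftilde_basis_eq)
qed

text \<open>The sign does not depend on \<open>p\<close>, so it leaves the sum over monomials, and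
  the reversed monomials assemble to \<open>Jtilde n c\<close>.\<close>

theorem Ftilde_reflect_Ftilde_inv:
  assumes "n \<ge> 1" "c \<in> poly_space n"
  shows "Ftilde n (Ftilde_inv n c \<circ>\<^sub>p [:- of_nat n, -1:]) =
    smult ((-1) ^ (n - 1)) (Jtilde n c)"
proof -
  have "Ftilde n (Ftilde_inv n c \<circ>\<^sub>p [:- of_nat n, -1:]) =
      (\<Sum>p<n. smult (coeff c p) (Ftilde n (Ftilde_inv n (monom 1 p) \<circ>\<^sub>p [:- of_nat n, -1:])))"
    unfolding Ftilde_inv_eq_sum[OF assms]
    by (simp only: module_hom_sum_smult[OF module_hom_pcompose]
        module_hom_sum_smult[OF module_hom_Ftilde])
  also have "\<dots> = (\<Sum>p<n. smult (coeff c p) (smult ((-1) ^ (n - 1)) (monom 1 (n - 1 - p))))"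
    by (intro sum.cong refl) (simp only: Ftilde_reflect_Ftilde_inv_monom lessThan_iff)
  also have "\<dots> = smult ((-1) ^ (n - 1)) (Jtilde n c)"
    by (simp add: Jtilde_def smult_sum_right smult_monom mult_ac)
  finally show ?thesis .
qed

text \<open>Cutting off at \<open>n\<close> coefficients loses nothing of S x^j, which is then
  expanded in monomials under \<open>T\<close>. Linearity is asked of \<open>T\<close> only, so that
  \<open>Ftilde_inv n\<close> can serve as \<open>S\<close>.\<close>

lemma op_mat_mult:
  assumes "n \<ge> 1" "module_hom smult smult T" "\<And>j. j < n \<Longrightarrow> S (monom 1 j) \<in> poly_space n"
  shows "op_mat n T * op_mat n S = op_mat n (T \<circ> S)"
proof (rule eq_matI)
  fix i j assume "i < dim_row (op_mat n (T \<circ> S))" "j < dim_col (op_mat n (T \<circ> S))"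
  then have ij: "i < n" "j < n"
    by (simp_all add: op_mat_def)
  have "T (S (monom 1 j)) = (\<Sum>k<n. smult (coeff (S (monom 1 j)) k) (T (monom 1 k)))"
    by (subst poly_space_eq_sum_monom[OF assms(1) assms(3)[OF ij(2)]])
       (rule module_hom_sum_smult[OF assms(2)])
  then show "(op_mat n T * op_mat n S) $$ (i, j) = op_mat n (T \<circ> S) $$ (i, j)"
    using ij by (simp add: op_mat_def scalar_prod_def coeff_sum atLeast0LessThan mult.commute)
qed (simp_all add: op_mat_def)

theorem theorem8p3:
  fixes n :: nat
  assumes "n \<ge> 1"
  shows "(\<forall>c :: complex poly. degree c \<le> n - 1 \<longrightarrow>
            (let d = Ftilde_inv n c in
              \<forall>x. x \<noteq> 0 \<longrightarrow>
                poly (Ftilde n (d \<circ>\<^sub>p [:- of_nat n, -1:])) x =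
                (-1) ^ (n - 1) * x ^ (n - 1) * poly c (1 / x))) \<and>
         op_mat n (Ftilde n) * op_mat n (shift (of_nat n)) * op_mat n reflection *
           op_mat n (Ftilde_inv n) =
         (-1) ^ (n - 1) \<cdot>\<^sub>m op_mat n (Jtilde n)"
proof (intro conjI allI impI)
  fix c :: "complex poly" assume "degree c \<le> n - 1"
  then have c: "c \<in> poly_space n"
    by (simp add: poly_space_def)
  show "let d = Ftilde_inv n c in \<forall>x. x \<noteq> 0 \<longrightarrow>
      poly (Ftilde n (d \<circ>\<^sub>p [:- of_nat n, -1:])) x =
      (-1) ^ (n - 1) * x ^ (n - 1) * poly c (1 / x)"
    \<comment> \<open>At 0, where 1 / 0 = 0, the two sides can differ: \<open>Jtilde n c\<close>
      takes the value \<open>coeff c (n - 1)\<close> there.\<close>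
    unfolding Let_def Ftilde_reflect_Ftilde_inv[OF assms c]
    by (simp add: poly_Jtilde[OF assms c])
next
  have mono: "monom 1 j \<in> poly_space n" if "j < n" for j
    using that by (simp add: poly_space_def degree_monom_eq)
  have shift: "module_hom smult smult (shift a)" for a
    using module_hom_pcompose[of "[:a, 1:]"] by (simp add: shift_def [abs_def])
  have refl: "module_hom smult smult reflection"
    using module_hom_pcompose[of "[:0, -1:]"] by (simp add: reflection_def [abs_def])
  \<comment> \<open>The reflection acts first: d(-x) shifted by n is d(-(x + n)).\<close>
  have sr: "shift (of_nat n) (reflection d) = d \<circ>\<^sub>p [:- of_nat n, -1:]" for d
    by (simp add: shift_def reflection_def pcompose_assoc[symmetric] pcompose_pCons)
  \<comment> \<open>Products are merged from the left, so \<open>Ftilde_inv n\<close> enters only as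
    the last right-hand factor.\<close>
  let ?FS = "Ftilde n \<circ> shift (of_nat n)"
  have FS: "module_hom smult smult ?FS"
    by (rule module_hom_compose[OF shift module_hom_Ftilde])
  have FSR: "module_hom smult smult (?FS \<circ> reflection)"
    by (rule module_hom_compose[OF refl FS])
  have "op_mat n (Ftilde n) * op_mat n (shift (of_nat n)) = op_mat n ?FS"
    by (rule op_mat_mult[OF assms module_hom_Ftilde])
       (simp only: shift_def pcompose_linear_in_poly_space mono)
  moreover have "op_mat n ?FS * op_mat n reflection = op_mat n (?FS \<circ> reflection)"
    by (rule op_mat_mult[OF assms FS])
       (simp only: reflection_def pcompose_linear_in_poly_space mono)
  moreover have "op_mat n (?FS \<circ> reflection) * op_mat n (Ftilde_inv n) =
      op_mat n (?FS \<circ> reflection \<circ> Ftilde_inv n)"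
    by (rule op_mat_mult[OF assms FSR]) (simp only: Ftilde_inv_in_poly_space assms mono)
  \<comment> \<open>Column \<open>j\<close> is the polynomial identity for c = x^j.\<close>
  moreover have "op_mat n (?FS \<circ> reflection \<circ> Ftilde_inv n) =
      (-1) ^ (n - 1) \<cdot>\<^sub>m op_mat n (Jtilde n)"
    by (rule eq_matI)
       (simp_all add: op_mat_def sr Ftilde_reflect_Ftilde_inv[OF assms mono, simplified])
  ultimately show "op_mat n (Ftilde n) * op_mat n (shift (of_nat n)) * op_mat n reflection *
      op_mat n (Ftilde_inv n) = (-1) ^ (n - 1) \<cdot>\<^sub>m op_mat n (Jtilde n)"
    by simp
qed

end
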